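(* Let $p$ be an odd prime. Let $G$ be a finite group that is potentially $p$-realizable, and let $N$ be a normal subgroup of $G$. Then $G/N$ is potentially $p$-realizable.
   Context: Conjugation is written $x^y = y^{-1}xy$. A finite group $G$ is potentially $p$-realizable if it has a filtration $G \supseteq G_0 \supseteq G_1$ such that: (1) $G_0$ and $G_1$ are normal in $G$; (2) $G/G_0$ is cyclic, generated by (the image of) some $\sigma \in G$; (3) $G_0/G_1$ is cyclic of order relatively prime to $p$, generated by (the image of) some $\tau \in G_0$; (4) $\tau^\sigma = \tau^p$ in $G$; (5) $G_1$ is a $p$-group. *)

theory Defs
  imports "HOL-Algebra.Elementary_Groups" "HOL-Computational_Algebra.Primes"
begin

definition conjugate :: "('a, 'b) monoid_scheme \<Rightarrow> 'a \<Rightarrow> 'a \<Rightarrow> 'a"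
  where "conjugate G x y = inv\<^bsub>G\<^esub> y \<otimes>\<^bsub>G\<^esub> x \<otimes>\<^bsub>G\<^esub> y"

text \<open>A finite group is a \<open>p\<close>-group if its order is a power of \<open>p\<close>; the trivial group counts.\<close>

definition finite_p_group :: "nat \<Rightarrow> ('a, 'b) monoid_scheme \<Rightarrow> bool"
  where "finite_p_group p G \<longleftrightarrow> group G \<and> finite (carrier G) \<and> (\<exists>n. order G = p ^ n)"

text \<open>Same sense of generation as in \<^const>\<open>cyclic_group\<close>, with the generator made explicit.\<close>

definition cyclic_generated_by :: "('a, 'b) monoid_scheme \<Rightarrow> 'a \<Rightarrow> bool"
  where "cyclic_generated_by G x \<longleftrightarrow> x \<in> carrier G \<and> subgroup_generated G {x} = G"

text \<open>The relation \<open>conjugate G \<tau> \<sigma> = \<tau> [^]\<^bsub>G\<^esub> p\<close> is required in \<open>G\<close> itself, not merely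
  modulo \<open>G1\<close>, so it constrains the chosen representatives \<open>\<sigma>\<close> and \<open>\<tau>\<close>.\<close>

definition potentially_realizable :: "nat \<Rightarrow> ('a, 'b) monoid_scheme \<Rightarrow> bool"
  where "potentially_realizable p G \<longleftrightarrow>
    group G \<and> finite (carrier G) \<and>
    (\<exists>G0 G1 \<sigma> \<tau>.
       G1 \<subseteq> G0 \<and> G0 \<lhd> G \<and> G1 \<lhd> G \<and>
       \<sigma> \<in> carrier G \<and> cyclic_generated_by (G Mod G0) (G0 #>\<^bsub>G\<^esub> \<sigma>) \<and>
       \<tau> \<in> G0 \<and> cyclic_generated_by (G\<lparr>carrier := G0\<rparr> Mod G1) (G1 #>\<^bsub>G\<^esub> \<tau>) \<and>
       coprime (order (G\<lparr>carrier := G0\<rparr> Mod G1)) p \<and>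
       conjugate G \<tau> \<sigma> = \<tau> [^]\<^bsub>G\<^esub> p \<and>
       finite_p_group p (G\<lparr>carrier := G1\<rparr>))"

end

theory Submission
  imports Defs
begin

text \<open>Push the filtration of \<open>G\<close> and the elements \<open>\<sigma>\<close>, \<open>\<tau>\<close> forward along an epimorphism
  \<open>h : G \<rightarrow> H\<close>. Each subquotient of \<open>G\<close> maps onto the corresponding subquotient of \<open>H\<close>, which
  transports the generators and makes the orders in \<open>H\<close> divide those in \<open>G\<close>; the relation
  \<open>\<tau>\<^sup>\<sigma> = \<tau>\<^sup>p\<close> is preserved by any homomorphism.\<close>

text \<open>By the first isomorphism theorem the order of \<open>H\<close> is the index of the
  kernel, which divides the order of \<open>G\<close> by Lagrange.\<close>

lemma (in group_hom) order_dvd_of_surj: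
  assumes "h ` carrier G = carrier H"
  shows "order H dvd order G"
proof -
  have "order (G Mod kernel G H h) = order H"
    using FactGroup_iso[OF assms] iso_same_card by (auto simp: order_def)
  moreover have "card (rcosets (kernel G H h)) * card (kernel G H h) = order G"
    by (rule G.lagrange[OF subgroup_kernel])
  ultimately show ?thesis
    by (metis FactGroup_def dvd_triv_left order_def partial_object.select_convs(1))
qed

lemma (in group_hom) cyclic_generated_by_of_surj:
  assumes surj: "h ` carrier G = carrier H" and "cyclic_generated_by G x"
  shows "cyclic_generated_by H (h x)"
proof -
  have x: "x \<in> carrier G" and "subgroup_generated G {x} = G"
    using assms(2) by (auto simp: cyclic_generated_by_def)
  then have "generate G {x} = carrier G"
    by (metis Int_insert_right_if1 Int_empty_right carrier_subgroup_generated)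
  then have "generate H {h x} = carrier H"
    using generate_img[of "{x}"] x surj by simp
  \<comment> \<open>\<open>subgroup_generated\<close> changes only the carrier of the record, so
    equality of carriers gives equality of the structures.\<close>
  then show ?thesis
    using x by (simp add: cyclic_generated_by_def subgroup_generated_def)
qed

lemma (in group_hom) normal_image_of_surj:
  assumes surj: "h ` carrier G = carrier H" and "K \<lhd> G"
  shows "h ` K \<lhd> H"
proof -
  have sub: "subgroup K G"
    using \<open>K \<lhd> G\<close> by (rule normal_imp_subgroup)
  have "y \<otimes>\<^bsub>H\<^esub> k \<otimes>\<^bsub>H\<^esub> inv\<^bsub>H\<^esub> y \<in> h ` K"
    if y: "y \<in> carrier H" and k: "k \<in> h ` K" for y k
  proof -
    obtain x where x: "y = h x" "x \<in> carrier G"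
      using y surj by blast
    obtain z where z: "k = h z" "z \<in> K"
      using k by blast
    have "z \<in> carrier G"
      using sub z(2) by (rule subgroup.mem_carrier)
    then have "y \<otimes>\<^bsub>H\<^esub> k \<otimes>\<^bsub>H\<^esub> inv\<^bsub>H\<^esub> y = h (x \<otimes> z \<otimes> inv x)"
      using x z by simp
    moreover have "x \<otimes> z \<otimes> inv x \<in> K"
      using \<open>K \<lhd> G\<close> x(2) z(2) by (rule normal.inv_op_closed2)
    ultimately show ?thesis
      by simp
  qed
  then show ?thesis
    unfolding H.normal_inv_iff using subgroup_img_is_subgroup[OF sub] by simp
qed

text \<open>The induced map on quotients is the direct image of cosets as sets, so no
  representatives are chosen and well-definedness is not an issue.\<close>

lemma (in group_hom) FactGroup_image:
  assumes surj: "h ` carrier G = carrier H" and "K \<lhd> G"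
  shows "group_hom (G Mod K) (H Mod h ` K) ((`) h)"
    and "(`) h ` carrier (G Mod K) = carrier (H Mod h ` K)"
    and "x \<in> carrier G \<Longrightarrow> h ` (K #> x) = h ` K #>\<^bsub>H\<^esub> h x"
proof -
  interpret K: normal K G by fact
  have coset: "h ` (K #> x) = h ` K #>\<^bsub>H\<^esub> h x" if "x \<in> carrier G" for x
    by (rule coset_hom(2)[OF homh K.subset that])
  then show "x \<in> carrier G \<Longrightarrow> h ` (K #> x) = h ` K #>\<^bsub>H\<^esub> h x" .
  show onto: "(`) h ` carrier (G Mod K) = carrier (H Mod h ` K)"
    using coset by (simp add: carrier_FactGroup image_image flip: surj)
  have "(`) h \<in> hom (G Mod K) (H Mod h ` K)"
  proof (rule homI)
    show "h ` X \<in> carrier (H Mod h ` K)" if "X \<in> carrier (G Mod K)" for X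
      using that onto by blast
    show "h ` (X \<otimes>\<^bsub>G Mod K\<^esub> Y) = h ` X \<otimes>\<^bsub>H Mod h ` K\<^esub> h ` Y"
      if "X \<in> carrier (G Mod K)" "Y \<in> carrier (G Mod K)" for X Y
    \<comment> \<open>The product in a factor group is the product of sets, and \<open>h\<close>
      commutes with products of subsets of the carrier.\<close>
    proof -
      have "X \<subseteq> carrier G" "Y \<subseteq> carrier G"
        using that K.subset by (auto simp: carrier_FactGroup dest: G.r_coset_subset_G)
      then show ?thesis
        using set_mult_hom[OF homh] by (simp add: FactGroup_def)
    qed
  qed
  then show "group_hom (G Mod K) (H Mod h ` K) ((`) h)"
    using K.factorgroup_is_group normal.factorgroup_is_group normal_image_of_surj[OF assms]
    by (auto simp: group_hom_def group_hom_axioms_def)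
qed

lemma (in group_hom) group_hom_restrict:
  assumes "subgroup K G"
  shows "group_hom (G\<lparr>carrier := K\<rparr>) (H\<lparr>carrier := h ` K\<rparr>) h"
proof -
  have "group (G\<lparr>carrier := K\<rparr>)"
    using assms by (rule G.subgroup_imp_group)
  moreover have "group (H\<lparr>carrier := h ` K\<rparr>)"
    using subgroup_img_is_subgroup[OF assms] by (rule H.subgroup_imp_group)
  moreover have "h \<in> hom (G\<lparr>carrier := K\<rparr>) (H\<lparr>carrier := h ` K\<rparr>)"
    using subgroup.subset[OF assms] by (auto simp: hom_def subset_iff)
  ultimately show ?thesis
    by (simp add: group_hom_def group_hom_axioms_def)
qed

lemma (in group_hom) finite_p_group_image:
  assumes "prime p" "subgroup K G" "finite_p_group p (G\<lparr>carrier := K\<rparr>)"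
  shows "finite_p_group p (H\<lparr>carrier := h ` K\<rparr>)"
proof -
  interpret K: group_hom "G\<lparr>carrier := K\<rparr>" "H\<lparr>carrier := h ` K\<rparr>" h
    by (rule group_hom_restrict) fact
  obtain n where "finite K" "order (G\<lparr>carrier := K\<rparr>) = p ^ n"
    using assms(3) by (auto simp: finite_p_group_def)
  moreover have "order (H\<lparr>carrier := h ` K\<rparr>) dvd order (G\<lparr>carrier := K\<rparr>)"
    by (rule K.order_dvd_of_surj) simp
  \<comment> \<open>A divisor of a power of a prime is again a power of that prime.\<close>
  ultimately show ?thesis
    using divides_primepow_nat[OF \<open>prime p\<close>] K.H.is_group
    by (auto simp: finite_p_group_def)
qed

lemma (in group_hom) conjugate_hom:
  assumes "x \<in> carrier G" "y \<in> carrier G"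
  shows "conjugate H (h x) (h y) = h (conjugate G x y)"
  using assms by (simp add: conjugate_def)

text \<open>For a general epimorphism the witnesses are the plain images \<open>h\<close>
  G0\<open>,\<close>h \<open>G1\<close>, \<open>h \<sigma>\<close>, \<open>h \<tau>\<close>; for the
  projection onto G/N the two subgroups are G0 N/N and G1 N/N.\<close>

lemma (in group_hom) potentially_realizable_of_surj:
  assumes "prime p" and surj: "h ` carrier G = carrier H" and "potentially_realizable p G"
  shows "potentially_realizable p H"
proof -
  obtain G0 G1 \<sigma> \<tau> where fin: "finite (carrier G)"
    and G0: "G0 \<lhd> G" and G1: "G1 \<subseteq> G0" "G1 \<lhd> G"
    and \<sigma>: "\<sigma> \<in> carrier G" "cyclic_generated_by (G Mod G0) (G0 #> \<sigma>)"
    and \<tau>: "\<tau> \<in> G0" "cyclic_generated_by (G\<lparr>carrier := G0\<rparr> Mod G1) (G1 #> \<tau>)"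
    and cop: "coprime (order (G\<lparr>carrier := G0\<rparr> Mod G1)) p"
    and rel: "conjugate G \<tau> \<sigma> = \<tau> [^] p"
    and pgroup: "finite_p_group p (G\<lparr>carrier := G1\<rparr>)"
    using assms(3) unfolding potentially_realizable_def by blast
  have sub: "subgroup G0 G" "subgroup G1 G"
    using G0 G1 by (auto intro: normal_imp_subgroup)
  have \<tau>G: "\<tau> \<in> carrier G"
    using sub(1) \<tau>(1) by (rule subgroup.mem_carrier)
  interpret R: group_hom "G\<lparr>carrier := G0\<rparr>" "H\<lparr>carrier := h ` G0\<rparr>" h
    by (rule group_hom_restrict) fact
  have R_surj: "h ` carrier (G\<lparr>carrier := G0\<rparr>) = carrier (H\<lparr>carrier := h ` G0\<rparr>)"
    by simp
  \<comment> \<open>The second subquotient is formed inside \<open>G0\<close>, so its induced map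
    must come from the restriction \<open>R\<close> of \<open>h\<close>.\<close>
  have G1_normal: "G1 \<lhd> G\<lparr>carrier := G0\<rparr>"
    using G.normal_restrict_supergroup sub(1) G1 by blast
  interpret Q: group_hom "G Mod G0" "H Mod h ` G0" "(`) h"
    by (rule FactGroup_image(1)[OF surj G0])
  interpret T: group_hom "G\<lparr>carrier := G0\<rparr> Mod G1" "H\<lparr>carrier := h ` G0\<rparr> Mod h ` G1" "(`) h"
    by (rule R.FactGroup_image(1)[OF R_surj G1_normal])
  note Q_surj = FactGroup_image(2)[OF surj G0]
  note T_surj = R.FactGroup_image(2)[OF R_surj G1_normal]
  have "cyclic_generated_by (H Mod h ` G0) (h ` G0 #>\<^bsub>H\<^esub> h \<sigma>)"
    using Q.cyclic_generated_by_of_surj[OF Q_surj \<sigma>(2)] FactGroup_image(3)[OF surj G0 \<sigma>(1)]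
    by simp
  moreover have "cyclic_generated_by (H\<lparr>carrier := h ` G0\<rparr> Mod h ` G1) (h ` G1 #>\<^bsub>H\<^esub> h \<tau>)"
    using T.cyclic_generated_by_of_surj[OF T_surj \<tau>(2)] FactGroup_image(3)[OF surj G1(2) \<tau>G]
    by simp
  moreover have "coprime (order (H\<lparr>carrier := h ` G0\<rparr> Mod h ` G1)) p"
    \<comment> \<open>Coprimality to \<open>p\<close> passes to divisors.\<close>
    using T.order_dvd_of_surj[OF T_surj] cop coprime_divisors dvd_refl by blast
  moreover have "conjugate H (h \<tau>) (h \<sigma>) = h \<tau> [^]\<^bsub>H\<^esub> p"
    using conjugate_hom[OF \<tau>G \<sigma>(1)] rel hom_nat_pow[OF \<tau>G] by simp
  moreover have "finite_p_group p (H\<lparr>carrier := h ` G1\<rparr>)"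
    using \<open>prime p\<close> sub(2) pgroup by (rule finite_p_group_image)
  moreover have "h ` G0 \<lhd> H" "h ` G1 \<lhd> H"
    using normal_image_of_surj[OF surj] G0 G1(2) by auto
  moreover have "h ` G1 \<subseteq> h ` G0" "h \<tau> \<in> h ` G0" "h \<sigma> \<in> carrier H"
    using G1(1) \<tau>(1) \<sigma>(1) by auto
  moreover have "finite (carrier H)"
    using fin by (simp flip: surj)
  ultimately show ?thesis
    unfolding potentially_realizable_def using H.is_group
    by (intro conjI exI[of _ "h ` G0"] exI[of _ "h ` G1"] exI[of _ "h \<sigma>"] exI[of _ "h \<tau>"])
qed

theorem proposition2p4:
  fixes p :: nat and G :: "('a, 'b) monoid_scheme" and N :: "'a set"
  assumes "prime p" and "odd p"
    and "group G" and "finite (carrier G)"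
    and "potentially_realizable p G"
    and "N \<lhd> G"
  shows "potentially_realizable p (G Mod N)"
proof -
  interpret N: normal N G by fact
  \<comment> \<open>This is the natural projection; it is onto because the carrier of
    \<open>G Mod N\<close> is the set of all cosets \<open>N #> a\<close>.\<close>
  interpret group_hom G "G Mod N" "\<lambda>a. N #>\<^bsub>G\<^esub> a"
    using N.r_coset_hom_Mod N.factorgroup_is_group \<open>group G\<close>
    by (simp add: group_hom_def group_hom_axioms_def)
  show ?thesis
    using \<open>prime p\<close> carrier_FactGroup[symmetric] \<open>potentially_realizable p G\<close>
    by (rule potentially_realizable_of_surj)
qed

end
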